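(* Bounded--error linear--space sweeping PCAs can recognize uncountably many languages in subquadratic time.
   Context: A PCA is a two--way probabilistic finite automaton (arbitrary real transition probabilities), reading its input between a left end-marker and a right end-marker (the dollar sign \$), augmented with a counter (integer register, initially zero, whose zero-status can be tested and which can be changed by $+1,0,-1$ per step); space is the maximum counter value. It is sweeping if its input head changes direction only on the end-markers. Bounded error: members accepted with probability $\ge 1-\epsilon$, non-members with probability $\le\epsilon$, $\epsilon<1/2$. *)

theory Defs
  imports "HOL-Probability.Probability" "HOL-Library.Landau_Symbols"
begin

datatype 'a tape_symbol = Left_End | Letter 'a | Right_End

text \<open>
  The boolean argument of \<open>trans\<close> is the result of the zero test on the counter. An outcome
  \<open>(q, d, e)\<close> enters state \<open>q\<close>, moves the head by \<open>d\<close> and adds \<open>e\<close> to the counter.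
\<close>

record ('q, 'a) pca =
  states :: "'q set"
  alphabet :: "'a set"
  start :: 'q
  accept :: 'q
  reject :: 'q
  trans :: "'q \<Rightarrow> 'a tape_symbol \<Rightarrow> bool \<Rightarrow> ('q \<times> int \<times> int) pmf"

definition tape_alphabet :: "('q, 'a) pca \<Rightarrow> 'a tape_symbol set" where
  "tape_alphabet M = {Left_End, Right_End} \<union> Letter ` alphabet M"

definition is_pca :: "('q, 'a) pca \<Rightarrow> bool" where
  "is_pca M \<longleftrightarrow>
     finite (states M) \<and> finite (alphabet M) \<and> alphabet M \<noteq> {} \<and>
     start M \<in> states M \<and> accept M \<in> states M \<and> reject M \<in> states M \<and> accept M \<noteq> reject M \<and>
     (\<forall>q \<in> states M - {accept M, reject M}. \<forall>a \<in> tape_alphabet M. \<forall>z.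
        \<forall>(q', d, e) \<in> set_pmf (trans M q a z).
          q' \<in> states M \<and> d \<in> {-1, 0, 1} \<and> e \<in> {-1, 0, 1} \<and>
          (a = Left_End \<longrightarrow> d \<noteq> -1) \<and> (a = Right_End \<longrightarrow> d \<noteq> 1))"

text \<open>
  The left end-marker is at position \<open>0\<close>, the letters of \<open>w\<close> are at positions \<open>1, ..., length w\<close>,
  and the right end-marker is at position \<open>length w + 1\<close>.
\<close>

definition tape :: "'a list \<Rightarrow> int \<Rightarrow> 'a tape_symbol" where
  "tape w i = (if i \<le> 0 then Left_End
               else if i \<le> int (length w) then Letter (w ! nat (i - 1))
               else Right_End)"

text \<open>Configurations consist of the state, the head position and the counter value.\<close>

type_synonym 'q config = "'q \<times> int \<times> int"

definition state :: "'q config \<Rightarrow> 'q" where "state c = fst c"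
definition head :: "'q config \<Rightarrow> int" where "head c = fst (snd c)"
definition counter :: "'q config \<Rightarrow> int" where "counter c = snd (snd c)"

definition initial :: "('q, 'a) pca \<Rightarrow> 'q config" where
  "initial M = (start M, 0, 0)"

definition halted :: "('q, 'a) pca \<Rightarrow> 'q config \<Rightarrow> bool" where
  "halted M c \<longleftrightarrow> state c \<in> {accept M, reject M}"

definition step :: "('q, 'a) pca \<Rightarrow> 'a list \<Rightarrow> 'q config \<Rightarrow> 'q config pmf" where
  "step M w c =
     (if halted M c then return_pmf c
      else map_pmf (\<lambda>(q, d, e). (q, head c + d, counter c + e))
             (trans M (state c) (tape w (head c)) (counter c = 0)))"

primrec run :: "('q, 'a) pca \<Rightarrow> 'a list \<Rightarrow> nat \<Rightarrow> 'q config pmf" where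
  "run M w 0 = return_pmf (initial M)"
| "run M w (Suc k) = bind_pmf (run M w k) (step M w)"

text \<open>
  Halting configurations are absorbing, so the probability of having accepted within \<open>k\<close> steps
  is nondecreasing in \<open>k\<close>, and its supremum is the probability of eventually accepting.
\<close>

definition accept_prob :: "('q, 'a) pca \<Rightarrow> 'a list \<Rightarrow> real" where
  "accept_prob M w = (SUP k. measure_pmf.prob (run M w k) {c. state c = accept M})"

definition recognizes :: "('q, 'a) pca \<Rightarrow> real \<Rightarrow> 'a list set \<Rightarrow> bool" where
  "recognizes M \<epsilon> L \<longleftrightarrow>
     L \<subseteq> lists (alphabet M) \<and>
     (\<forall>w \<in> lists (alphabet M).
        (w \<in> L \<longrightarrow> accept_prob M w \<ge> 1 - \<epsilon>) \<and>
        (w \<notin> L \<longrightarrow> accept_prob M w \<le> \<epsilon>))"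

text \<open>
  A computation path is an infinite sequence of configurations all of whose finite prefixes
  have positive probability; a path that halts stays in its halting configuration.
\<close>

definition comp_path :: "('q, 'a) pca \<Rightarrow> 'a list \<Rightarrow> (nat \<Rightarrow> 'q config) \<Rightarrow> bool" where
  "comp_path M w \<rho> \<longleftrightarrow>
     \<rho> 0 = initial M \<and> (\<forall>k. \<rho> (Suc k) \<in> set_pmf (step M w (\<rho> k)))"

definition move :: "(nat \<Rightarrow> 'q config) \<Rightarrow> nat \<Rightarrow> int" where
  "move \<rho> k = head (\<rho> (Suc k)) - head (\<rho> k)"

text \<open>
  A change of direction is a pair of opposite moves with only stationary steps in between;
  the second move must start on an end-marker.
\<close>

definition sweeping :: "('q, 'a) pca \<Rightarrow> bool" where
  "sweeping M \<longleftrightarrow>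
     (\<forall>w \<in> lists (alphabet M). \<forall>\<rho>. comp_path M w \<rho> \<longrightarrow>
        (\<forall>i j. i < j \<and> move \<rho> i \<noteq> 0 \<and> (\<forall>k. i < k \<and> k < j \<longrightarrow> move \<rho> k = 0) \<and>
               move \<rho> j = - move \<rho> i \<longrightarrow>
           tape w (head (\<rho> j)) \<in> {Left_End, Right_End}))"

text \<open>The counter may be negative, so its size is measured by its absolute value.\<close>

definition space_bounded :: "('q, 'a) pca \<Rightarrow> (nat \<Rightarrow> nat) \<Rightarrow> bool" where
  "space_bounded M s \<longleftrightarrow>
     (\<forall>w \<in> lists (alphabet M). \<forall>\<rho>. comp_path M w \<rho> \<longrightarrow>
        (\<forall>k. \<bar>counter (\<rho> k)\<bar> \<le> int (s (length w))))"

definition time_bounded :: "('q, 'a) pca \<Rightarrow> (nat \<Rightarrow> nat) \<Rightarrow> bool" where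
  "time_bounded M t \<longleftrightarrow>
     (\<forall>w \<in> lists (alphabet M). \<forall>\<rho>. comp_path M w \<rho> \<longrightarrow> halted M (\<rho> (t (length w))))"

end

theory Submission
  imports Defs
begin

text \<open>
  A single left-to-right pass suffices. A word is read as an unmarked run of the letter \<open>0\<close>
  followed by a list of blocks, each a marker \<open>1\<close>, \<open>2\<close> or \<open>3\<close> and a further run of \<open>0\<close>. It is
  well-formed if, starting from the length of the unmarked run, it has \<open>M\<close> blocks
  with marker \<open>1\<close> whose lengths grow by the factor 100, followed by \<open>M\<close> blocks with marker \<open>2\<close> or
  \<open>3\<close>, all of the length \<open>g \<ge> 100\<^sup>M\<close> reached so far. If \<open>i\<close> of these have marker \<open>2\<close>, the
  machine compares the number of heads in \<open>N = M * g\<close> tosses of a coin of bias \<open>p\<close> with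
  \<open>i * g\<close>, that is, it decides whether \<open>i / M < p\<close>. By Hoeffding's inequality this is reliable
  as soon as \<open>\<bar>p - i / M\<bar> \<ge> 1 / 10\<^sup>M \<ge> 1 / sqrt N\<close>, and a union bound on Lebesgue measure
  shows that uncountably many \<open>p\<close> have this property for all \<open>i\<close> and \<open>M\<close>. (In the degenerate case
  \<open>N = 0\<close> the coin test is always passed.) Distinct such \<open>p\<close> are separated by a
  rational \<open>i / M\<close> and therefore yield distinct languages.

  One counter cannot run all tests in the same pass, so the machine picks one of them at random at
  the start: the block lengths at even positions against their successors, those at odd
  positions, the numbers of blocks, or the coin tosses. Each test is chosen with
  probability \<open>1 / 7\<close>, and with the remaining probability \<open>3 / 7\<close> the machine rejects outright. A
  well-formed word passes the first three tests surely and the last with probability at least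
  \<open>3 / 4\<close> or at most \<open>1 / 4\<close>, so it is accepted with probability at least \<open>15 / 28\<close> or at most
  \<open>13 / 28\<close>; an ill-formed one is accepted with probability at most \<open>3 / 7 < 13 / 28\<close>.
\<close>

section \<open>The machine\<close>

text \<open>
  \<open>Up\<close> stores the length of a block in the counter and \<open>Down k i\<close> compares the next block with
  \<open>k\<close> times this length, where \<open>i\<close> is the number of letters read modulo \<open>k\<close>; \<open>Skip\<close> shifts this
  pairing of blocks by one. In \<open>Toss m b\<close>, \<open>m\<close> is the last marker and \<open>b\<close> is the sign of the
  counter, which the machine can only test for zero; \<open>b\<close> carries no information while the
  counter is zero.
\<close>

datatype ctl =
  Start | Acc | Rej | Fail | Skip | Up | Down nat nat | Ascend | Plateau | Toss nat bool

instance ctl :: countable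
  by countable_datatype

text \<open>The 100 is the square of the 10 in \<open>separated\<close>: about
  \<open>100 ^ M\<close> tosses resolve a gap of \<open>1 / 10 ^ M\<close>.\<close>

definition factor :: "nat \<Rightarrow> nat" where
  "factor m = (if m = 1 then 100 else 1)"

definition toss_effect :: "nat \<Rightarrow> bool \<Rightarrow> int" where
  "toss_effect m h = (if h then 1 else 0) - (if m = 2 then 1 else 0)"

text \<open>In \<open>Toss\<close>, the effect at counter 0 fixes the new sign \<open>b\<close>;
  from a nonzero counter one step cannot cross zero, so \<open>b\<close> stays valid. The marker
  leading from \<open>Ascend\<close> to \<open>Plateau\<close> is itself charged, hence the -1
  there. In \<open>Down\<close>, a block that is too long drives the counter below zero, where the
  final zero test fails.\<close>

fun letter_step :: "real \<Rightarrow> ctl \<Rightarrow> nat \<Rightarrow> bool \<Rightarrow> (ctl \<times> int) pmf" where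
  "letter_step p Skip x z = return_pmf (if x = 0 then Skip else Up, 0)"
| "letter_step p Up x z = return_pmf (if x = 0 then (Up, 1) else (Down (factor x) 0, 0))"
| "letter_step p (Down k i) x z = return_pmf
     (if x = 0 then (if Suc i = k then (Down k 0, -1) else (Down k (Suc i), 0))
      else if i = 0 \<and> z then (Up, 0) else (Fail, 0))"
| "letter_step p Ascend x z = return_pmf
     (if x = 0 then (Ascend, 0) else if x = 1 then (Ascend, 1) else (Plateau, -1))"
| "letter_step p Plateau x z = return_pmf
     (if x = 0 then (Plateau, 0) else if x = 1 then (Fail, 0) else (Plateau, -1))"
| "letter_step p (Toss m b) x z =
     (if x = 0 \<and> m \<noteq> 1 then
        map_pmf (\<lambda>h. (Toss m (if z then 0 \<le> toss_effect m h else b), toss_effect m h)) (bernoulli_pmf p)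
      else return_pmf (Toss (if x = 0 then m else x) b, 0))"
| "letter_step p s x z = return_pmf (Fail, 0)"

fun passes :: "ctl \<Rightarrow> bool \<Rightarrow> bool" where
  "passes Skip z = True"
| "passes Up z = True"
| "passes (Down k i) z = (i = 0 \<and> z)"
| "passes Ascend z = z"
| "passes Plateau z = z"
| "passes (Toss m b) z = (z \<or> b)"
| "passes s z = False"

text \<open>\<open>Toss\<close> starts with marker 1 so that the unmarked run triggers no
  tosses.\<close>

definition branch :: "nat \<Rightarrow> ctl" where
  "branch i = (if i = 0 then Skip else if i = 1 then Up else if i = 2 then Ascend
               else if i = 3 then Toss 1 True else Fail)"

definition act :: "real \<Rightarrow> ctl \<Rightarrow> nat tape_symbol \<Rightarrow> bool \<Rightarrow> (ctl \<times> int \<times> int) pmf" where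
  "act p s a z = (case a of
     Left_End \<Rightarrow> map_pmf (\<lambda>i. (branch i, 1, 0)) (pmf_of_set {..<7})
   | Letter x \<Rightarrow> map_pmf (\<lambda>(s', e). (s', 1, e)) (letter_step p s x z)
   | Right_End \<Rightarrow> return_pmf (if passes s z then Acc else Rej, 0, 0))"

text \<open>The type \<open>ctl\<close> is infinite; this cuts out a finite part closed under the
  transitions, the \<open>k\<close> in \<open>Down k i\<close> being a value of
  \<open>factor\<close>.\<close>

fun controls :: "ctl \<Rightarrow> bool" where
  "controls (Down k i) = (k \<in> {1, 100} \<and> i < k)"
| "controls (Toss m b) = (m \<in> {1, 2, 3})"
| "controls s = True"

lemma finite_controls: "finite {s. controls s}"
proof (rule finite_subset)
  show "{s. controls s} \<subseteq> {Start, Acc, Rej, Fail, Skip, Up, Ascend, Plateau} \<union>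
     (\<lambda>(k, i). Down k i) ` ({1, 100} \<times> {..<100}) \<union>
     (\<lambda>(m, b). Toss m b) ` ({1, 2, 3} \<times> UNIV)" (is "_ \<subseteq> ?S")
  proof
    fix s assume "s \<in> {s. controls s}"
    then show "s \<in> ?S" by (cases s) force+
  qed
qed auto

definition machine :: "real \<Rightarrow> (nat, nat) pca" where
  "machine p = \<lparr>states = to_nat ` {s. controls s}, alphabet = {0, 1, 2, 3},
     start = to_nat Start, accept = to_nat Acc, reject = to_nat Rej,
     trans = (\<lambda>q a z. map_pmf (\<lambda>(s, d, e). (to_nat s, d, e)) (act p (from_nat q) a z))\<rparr>"

lemma machine_simps [simp]:
  "states (machine p) = to_nat ` {s. controls s}" "alphabet (machine p) = {0, 1, 2, 3}"
  "start (machine p) = to_nat Start" "accept (machine p) = to_nat Acc"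
  "reject (machine p) = to_nat Rej"
  "trans (machine p) (to_nat s) a z = map_pmf (\<lambda>(s, d, e). (to_nat s, d, e)) (act p s a z)"
  by (simp_all add: machine_def)

lemma letter_step_support:
  assumes "(s', e) \<in> set_pmf (letter_step p s x z)"
  shows "e \<in> {-1, 0, 1}" "s' \<noteq> Acc" "s' \<noteq> Rej"
  using assms
  by (cases "(p, s, x, z)" rule: letter_step.cases;
      auto simp: toss_effect_def split: if_splits)+

lemma letter_step_controls:
  assumes "(s', e) \<in> set_pmf (letter_step p s x z)" "controls s" "x \<in> {0, 1, 2, 3}"
  shows "controls s'"
  using assms
  by (cases "(p, s, x, z)" rule: letter_step.cases)
     (auto simp: factor_def split: if_splits)

lemma act_support:
  assumes "(s', d, e) \<in> set_pmf (act p s a z)"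
  shows "d \<in> {0, 1}" "e \<in> {-1, 0, 1}" "a = Right_End \<Longrightarrow> d = 0 \<and> e = 0 \<and> s' \<in> {Acc, Rej}"
    "a = Left_End \<Longrightarrow> d = 1 \<and> e = 0" "a \<noteq> Right_End \<Longrightarrow> d = 1 \<and> s' \<noteq> Acc \<and> s' \<noteq> Rej"
  using assms letter_step_support[of s' e p s]
  by (auto simp: act_def branch_def split: tape_symbol.splits if_splits)

lemma act_controls:
  assumes "(s', d, e) \<in> set_pmf (act p s a z)" "controls s" "a \<in> tape_alphabet (machine p)"
  shows "controls s'"
proof (cases a)
  case (Letter x)
  with assms show ?thesis
    using letter_step_controls[of s' e p s x z] by (auto simp: act_def tape_alphabet_def)
qed (use assms in \<open>auto simp: act_def branch_def split: if_splits\<close>)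

lemma is_pca_machine: "is_pca (machine p)"
proof -
  have *: "\<forall>(q', d, e) \<in> set_pmf (trans (machine p) q a z).
      q' \<in> states (machine p) \<and> d \<in> {-1, 0, 1} \<and> e \<in> {-1, 0, 1} \<and>
      (a = Left_End \<longrightarrow> d \<noteq> -1) \<and> (a = Right_End \<longrightarrow> d \<noteq> 1)"
    if q: "q \<in> states (machine p)" and a: "a \<in> tape_alphabet (machine p)" for q a z
  proof
    fix y assume y: "y \<in> set_pmf (trans (machine p) q a z)"
    from q obtain s where s: "q = to_nat s" "controls s" by auto
    with y obtain s' d e where y: "y = (to_nat s', d, e)" "(s', d, e) \<in> set_pmf (act p s a z)"
      by auto
    show "case y of (q', d, e) \<Rightarrow> q' \<in> states (machine p) \<and> d \<in> {-1, 0, 1} \<and> e \<in> {-1, 0, 1} \<and>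
        (a = Left_End \<longrightarrow> d \<noteq> -1) \<and> (a = Right_End \<longrightarrow> d \<noteq> 1)"
      using act_support[OF y(2)] act_controls[OF y(2) s(2) a] unfolding y(1) by auto
  qed
  show ?thesis
    unfolding is_pca_def
  proof (intro conjI)
    show "\<forall>q \<in> states (machine p) - {accept (machine p), reject (machine p)}.
        \<forall>a \<in> tape_alphabet (machine p). \<forall>z. \<forall>(q', d, e) \<in> set_pmf (trans (machine p) q a z).
          q' \<in> states (machine p) \<and> d \<in> {-1, 0, 1} \<and> e \<in> {-1, 0, 1} \<and>
          (a = Left_End \<longrightarrow> d \<noteq> -1) \<and> (a = Right_End \<longrightarrow> d \<noteq> 1)"
      by (rule ballI, rule ballI, rule allI, rule *) simp_all
  qed (simp_all add: finite_controls)
qed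

section \<open>Head position, counter and running time along computation paths\<close>

lemma step_support:
  assumes "c' \<in> set_pmf (step (machine p) w c)" "\<not> halted (machine p) c"
    and "0 \<le> head c" "state c \<in> range (to_nat :: ctl \<Rightarrow> nat)"
  shows "state c' \<in> range (to_nat :: ctl \<Rightarrow> nat)"
    and "head c \<le> int (length w) \<Longrightarrow> head c' = head c + 1"
    and "head c > int (length w) \<Longrightarrow>
           head c' = head c \<and> counter c' = counter c \<and> halted (machine p) c'"
    and "head c = 0 \<Longrightarrow> counter c' = counter c"
    and "\<bar>counter c' - counter c\<bar> \<le> 1"
proof -
  obtain s :: ctl where s: "state c = to_nat s" using assms(4) by auto
  obtain s' d e where c': "c' = (to_nat s', head c + d, counter c + e)"
    "(s', d, e) \<in> set_pmf (act p s (tape w (head c)) (counter c = 0))"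
    using assms(1,2) s by (auto simp: step_def)
  note sup = act_support[OF c'(2)]
  show "state c' \<in> range (to_nat :: ctl \<Rightarrow> nat)" "\<bar>counter c' - counter c\<bar> \<le> 1"
    using c'(1) sup(2) by (auto simp: state_def counter_def)
  show "head c \<le> int (length w) \<Longrightarrow> head c' = head c + 1"
    using c'(1) sup(5) by (auto simp: head_def tape_def)
  show "head c = 0 \<Longrightarrow> counter c' = counter c"
    using c'(1) sup(4) by (auto simp: counter_def tape_def)
  show "head c > int (length w) \<Longrightarrow>
      head c' = head c \<and> counter c' = counter c \<and> halted (machine p) c'"
    using c'(1) sup(3) by (auto simp: head_def counter_def state_def tape_def halted_def)
qed

lemma step_halted: "halted M c \<Longrightarrow> step M w c = return_pmf c"
  by (simp add: step_def)

text \<open>Until the right end-marker is reached, each step moves one cell to the right and changes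
  the counter by at most 1, so the time equals the head position, which bounds the counter. The last
  step leaves head and counter alone.\<close>

lemma comp_path_invariant:
  assumes "comp_path (machine p) w \<rho>"
  shows "state (\<rho> k) \<in> range (to_nat :: ctl \<Rightarrow> nat) \<and> 0 \<le> head (\<rho> k) \<and> head (\<rho> k) \<le> int (length w) + 1 \<and>
     \<bar>counter (\<rho> k)\<bar> \<le> head (\<rho> k) \<and>
     (halted (machine p) (\<rho> k) \<or> head (\<rho> k) = int k)"
proof (induction k)
  case 0
  then show ?case
    using assms by (auto simp: comp_path_def initial_def state_def head_def counter_def)
next
  case (Suc k)
  have st: "\<rho> (Suc k) \<in> set_pmf (step (machine p) w (\<rho> k))"
    using assms by (simp add: comp_path_def)
  show ?case
  proof (cases "halted (machine p) (\<rho> k)")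
    case True
    then show ?thesis using st Suc by (auto simp: step_halted)
  next
    case False
    note s = step_support[OF st False]
    show ?thesis
      using s Suc False by (cases "head (\<rho> k) \<le> int (length w)") auto
  qed
qed

lemma move_nonneg:
  assumes "comp_path (machine p) w \<rho>"
  shows "0 \<le> move \<rho> k"
proof (cases "halted (machine p) (\<rho> k)")
  case True
  have "\<rho> (Suc k) \<in> set_pmf (step (machine p) w (\<rho> k))"
    using assms by (simp add: comp_path_def)
  with True show ?thesis by (simp add: move_def step_halted)
next
  case False
  have st: "\<rho> (Suc k) \<in> set_pmf (step (machine p) w (\<rho> k))"
    using assms by (simp add: comp_path_def)
  show ?thesis
    using step_support[OF st False] comp_path_invariant[OF assms, of k]
    by (cases "head (\<rho> k) \<le> int (length w)") (auto simp: move_def)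
qed

text \<open>No move is negative, so a nonzero move is never followed by an opposite one and the
  condition holds vacuously.\<close>

lemma sweeping_machine: "sweeping (machine p)"
  unfolding sweeping_def
proof (intro ballI allI impI)
  fix w \<rho> i j
  assume "comp_path (machine p) w \<rho>"
    and *: "i < j \<and> move \<rho> i \<noteq> 0 \<and> (\<forall>k. i < k \<and> k < j \<longrightarrow> move \<rho> k = 0) \<and>
      move \<rho> j = - move \<rho> i"
  then have "0 \<le> move \<rho> i" "0 \<le> move \<rho> j" by (blast intro: move_nonneg)+
  with * show "tape w (head (\<rho> j)) \<in> {Left_End, Right_End}" by auto
qed

lemma space_bounded_machine: "space_bounded (machine p) (\<lambda>n. n + 1)"
  unfolding space_bounded_def
proof (intro ballI allI impI)
  fix w \<rho> k
  assume "comp_path (machine p) w \<rho>"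
  from comp_path_invariant[OF this, of k]
  show "\<bar>counter (\<rho> k)\<bar> \<le> int (length w + 1)" by auto
qed

lemma time_bounded_machine: "time_bounded (machine p) (\<lambda>n. n + 2)"
  unfolding time_bounded_def
proof (intro ballI allI impI)
  fix w \<rho>
  assume "comp_path (machine p) w \<rho>"
  \<comment> \<open>A path still running at this time would have its head beyond the right
    end-marker.\<close>
  from comp_path_invariant[OF this, of "length w + 2"]
  show "halted (machine p) (\<rho> (length w + 2))" by auto
qed

section \<open>Acceptance probability\<close>

text \<open>In contrast to \<open>run\<close>, the recursion peels off the first step, which matches
  recursion over the unread part of the word.\<close>

primrec iterate :: "('q, 'a) pca \<Rightarrow> 'a list \<Rightarrow> nat \<Rightarrow> 'q config \<Rightarrow> 'q config pmf" where
  "iterate M w 0 c = return_pmf c"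
| "iterate M w (Suc k) c = bind_pmf (step M w c) (iterate M w k)"

lemma iterate_Suc': "iterate M w (Suc k) c = bind_pmf (iterate M w k c) (step M w)"
proof (induction k arbitrary: c)
  case 0
  have "iterate M w 0 = return_pmf" by (simp add: fun_eq_iff)
  then show ?case by (simp add: bind_return_pmf bind_return_pmf')
next
  case (Suc k)
  have "iterate M w (Suc (Suc k)) c = bind_pmf (step M w c) (iterate M w (Suc k))"
    by simp
  also have "\<dots> = bind_pmf (step M w c) (\<lambda>c. bind_pmf (iterate M w k c) (step M w))"
    by (intro bind_pmf_cong refl) (rule Suc)
  finally show ?case by (simp add: bind_assoc_pmf)
qed

lemma run_eq_iterate: "run M w k = iterate M w k (initial M)"
  by (induction k) (simp_all add: iterate_Suc' del: iterate.simps(2))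

lemma iterate_halted: "halted M c \<Longrightarrow> iterate M w k c = return_pmf c"
  by (induction k) (simp_all add: step_halted bind_return_pmf)

text \<open>Accepting configurations are absorbing, so the indicator of acceptance is pointwise at
  most the probability of acceptance one step later.\<close>

lemma prob_accept_mono:
  assumes "j \<le> k"
  shows "measure_pmf.prob (run M w j) {c. state c = accept M}
       \<le> measure_pmf.prob (run M w k) {c. state c = accept M}"
  using assms
proof (induction k rule: dec_induct)
  case (step k)
  let ?A = "{c. state c = accept M}"
  have "emeasure (run M w k) ?A = (\<integral>\<^sup>+c. indicator ?A c \<partial>run M w k)"
    by simp
  also have "\<dots> \<le> (\<integral>\<^sup>+c. emeasure (Defs.step M w c) ?A \<partial>run M w k)"
    by (intro nn_integral_mono) (auto simp: indicator_def step_halted halted_def)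
  also have "\<dots> = emeasure (run M w (Suc k)) ?A"
    by simp
  finally show ?case
    using step.IH by (simp add: measure_pmf.emeasure_eq_measure)
qed auto

text \<open>The outcome of a test on the unread word \<open>w\<close>, with tape and head position
  abstracted away.\<close>

primrec verdict :: "real \<Rightarrow> nat list \<Rightarrow> ctl \<Rightarrow> int \<Rightarrow> bool pmf" where
  "verdict p [] s c = return_pmf (passes s (c = 0))"
| "verdict p (x # w) s c =
     bind_pmf (letter_step p s x (c = 0)) (\<lambda>(s', e). verdict p w s' (c + e))"

text \<open>Here \<open>u\<close> is the part already read. One step per letter and one on the right
  end-marker suffice; the \<open>j\<close> surplus steps idle in a halting configuration.\<close>

lemma verdict_iterate:
  assumes "s \<noteq> Acc" "s \<noteq> Rej"
  shows "map_pmf (\<lambda>c. state c = to_nat Acc)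
      (iterate (machine p) (u @ w) (Suc (length w + j)) (to_nat s, int (length u) + 1, c)) =
    verdict p w s c"
  using assms
proof (induction w arbitrary: u s c)
  case Nil
  have "iterate (machine p) u (Suc j) (to_nat s, int (length u) + 1, c) =
      return_pmf (to_nat (if passes s (c = 0) then Acc else Rej), int (length u) + 1, c)"
    using Nil
    by (simp add: step_def halted_def state_def head_def counter_def tape_def act_def
        bind_return_pmf iterate_halted)
  then show ?case by (simp add: state_def)
next
  case (Cons x w)
  have tape: "tape (u @ x # w) (int (length u) + 1) = Letter x"
      "tape (u @ x # w) (1 + int (length u)) = Letter x"
    by (simp_all add: tape_def nth_append)
  have "step (machine p) (u @ x # w) (to_nat s, int (length u) + 1, c) =
      map_pmf (\<lambda>(s', e). (to_nat s', int (length (u @ [x])) + 1, c + e)) (letter_step p s x (c = 0))"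
    using Cons.prems
    by (simp add: step_def halted_def state_def head_def counter_def tape act_def
        map_pmf_comp case_prod_unfold add.commute add.left_commute)
  then have "map_pmf (\<lambda>c. state c = to_nat Acc) (iterate (machine p) (u @ x # w)
        (Suc (length (x # w) + j)) (to_nat s, int (length u) + 1, c)) =
      bind_pmf (letter_step p s x (c = 0)) (\<lambda>(s', e). map_pmf (\<lambda>c. state c = to_nat Acc)
        (iterate (machine p) ((u @ [x]) @ w) (Suc (length w + j))
          (to_nat s', int (length (u @ [x])) + 1, c + e)))"
    by (simp add: bind_map_pmf map_bind_pmf case_prod_unfold del: iterate.simps(2) add: iterate.simps(2)[of _ _ "Suc _"])
  also have "\<dots> = bind_pmf (letter_step p s x (c = 0)) (\<lambda>(s', e). verdict p w s' (c + e))"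
    by (intro bind_pmf_cong refl, clarify, rule Cons.IH) (auto dest: letter_step_support)
  finally show ?case by simp
qed

lemma accept_prob_machine:
  "accept_prob (machine p) w =
     (pmf (verdict p w Skip 0) True + pmf (verdict p w Up 0) True +
      pmf (verdict p w Ascend 0) True + pmf (verdict p w (Toss 1 True) 0) True +
      3 * pmf (verdict p w Fail 0) True) / 7" (is "_ = ?P")
proof -
  let ?f = "\<lambda>k. measure_pmf.prob (run (machine p) w k) {c. state c = accept (machine p)}"
  \<comment> \<open>The value is the same for all step numbers from \<open>length w + 2\<close> on,
    so with monotonicity the supremum is attained.\<close>
  have eq: "?f (Suc (Suc (length w + j))) = ?P" for j
  proof -
    have "step (machine p) w (initial (machine p)) =
        map_pmf (\<lambda>i. (to_nat (branch i), 1, 0)) (pmf_of_set {..<7})"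
      by (simp add: step_def halted_def initial_def state_def head_def counter_def tape_def
          act_def map_pmf_comp)
    then have "map_pmf (\<lambda>c. state c = to_nat Acc) (run (machine p) w (Suc (Suc (length w + j)))) =
        bind_pmf (pmf_of_set {..<7}) (\<lambda>i. map_pmf (\<lambda>c. state c = to_nat Acc)
          (iterate (machine p) ([] @ w) (Suc (length w + j)) (to_nat (branch i), int (length ([] :: nat list)) + 1, 0)))"
      unfolding run_eq_iterate iterate.simps(2)[of _ _ "Suc _"]
      by (simp add: bind_map_pmf map_bind_pmf del: iterate.simps(2))
    also have "\<dots> = bind_pmf (pmf_of_set {..<7}) (\<lambda>i. verdict p w (branch i) 0)"
      by (intro bind_pmf_cong refl verdict_iterate) (auto simp: branch_def)
    finally have *: "map_pmf (\<lambda>c. state c = to_nat Acc) (run (machine p) w (Suc (Suc (length w + j)))) =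
      bind_pmf (pmf_of_set {..<7}) (\<lambda>i. verdict p w (branch i) 0)" .
    have "?f (Suc (Suc (length w + j))) =
        pmf (map_pmf (\<lambda>c. state c = to_nat Acc) (run (machine p) w (Suc (Suc (length w + j))))) True"
      by (simp add: pmf_map vimage_def)
    also have "\<dots> = (\<Sum>i<7. pmf (verdict p w (branch i) 0) True) / 7"
      unfolding * by (subst pmf_bind_pmf_of_set) (auto simp: lessThan_empty_iff)
    also have "\<dots> = ?P"
      by (simp add: eval_nat_numeral branch_def)
    finally show ?thesis .
  qed
  have le: "?f k \<le> ?P" for k
  proof -
    have "?f k \<le> ?f (Suc (Suc (length w + k)))" by (rule prob_accept_mono) simp
    then show ?thesis by (simp only: eq)
  qed
  show ?thesis
    unfolding accept_prob_def
  proof (rule cSup_eq_maximum)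
    show "?P \<in> range ?f" using eq[of 0] by (metis rangeI)
  qed (use le in auto)
qed

section \<open>The structural tests\<close>

definition encode :: "(nat \<times> nat) list \<Rightarrow> nat list" where
  "encode bs = concat (map (\<lambda>(m, x). m # replicate x 0) bs)"

lemma encode_simps [simp]:
  "encode [] = []" "encode ((m, x) # bs) = m # replicate x 0 @ encode bs"
  by (simp_all add: encode_def)

text \<open>Reading from the back, a letter 0 extends the unmarked run, and a marker turns the
  unmarked run behind it into a block.\<close>

lemma encode_exhaust:
  assumes "w \<in> lists {0, 1, 2, 3}"
  obtains x bs where "w = replicate x 0 @ encode bs" "fst ` set bs \<subseteq> {1, 2, 3}"
proof -
  have "\<exists>x bs. w = replicate x 0 @ encode bs \<and> fst ` set bs \<subseteq> {1, 2, 3}"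
    using assms
  proof (induction w)
    case Nil
    show ?case by (intro exI[of _ 0] exI[of _ "[]"]) simp
  next
    case (Cons a w)
    then obtain x bs where w: "w = replicate x 0 @ encode bs" "fst ` set bs \<subseteq> {1, 2, 3}"
      by auto
    show ?case
    proof (cases "a = 0")
      case True
      with w show ?thesis by (intro exI[of _ "Suc x"] exI[of _ bs]) simp
    next
      case False
      with w Cons.hyps show ?thesis
        by (intro exI[of _ 0] exI[of _ "(a, x) # bs"]) auto
    qed
  qed
  with that show ?thesis by blast
qed

primrec chained :: "nat \<Rightarrow> (nat \<times> nat) list \<Rightarrow> bool" where
  "chained x [] = True"
| "chained x (b # bs) = (snd b = factor (fst b) * x \<and> chained (snd b) bs)"

text \<open>The alternating halves of \<open>chained\<close>, matching the two pairings of blocks: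
  \<open>odd_chained\<close> is what a start in \<open>Up\<close> verifies,
  \<open>even_chained\<close> what a start in \<open>Skip\<close> verifies.\<close>

fun odd_chained even_chained :: "nat \<Rightarrow> (nat \<times> nat) list \<Rightarrow> bool" where
  "odd_chained x [] = True"
| "odd_chained x ((m, y) # bs) = (y = factor m * x \<and> even_chained y bs)"
| "even_chained x [] = True"
| "even_chained x ((m, y) # bs) = odd_chained y bs"

lemma chained_iff: "chained x bs \<longleftrightarrow> odd_chained x bs \<and> even_chained x bs"
proof (induction bs arbitrary: x)
  case (Cons b bs)
  then show ?case by (cases b) (simp, blast)
qed simp

text \<open>The argument \<open>c\<close> is the counter of \<open>Ascend\<close>: the surplus of
  markers 1 that later blocks still have to cancel.\<close>

fun peaked :: "int \<Rightarrow> (nat \<times> nat) list \<Rightarrow> bool" where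
  "peaked c [] = (c = 0)"
| "peaked c ((m, x) # bs) =
     (if m = 1 then peaked (c + 1) bs else 1 \<notin> fst ` set bs \<and> c = int (length bs) + 1)"

section \<open>Outcomes of the deterministic tests\<close>

lemma verdict_Fail: "verdict p w Fail c = return_pmf False"
  by (induction w arbitrary: c) (simp_all add: bind_return_pmf)

lemma verdict_Skip_replicate:
  "verdict p (replicate x 0 @ w) Skip c = verdict p w Skip c"
  by (induction x) (simp_all add: bind_return_pmf)

lemma verdict_Up_replicate:
  "verdict p (replicate x 0 @ w) Up c = verdict p w Up (c + int x)"
  by (induction x arbitrary: c) (simp_all add: bind_return_pmf add.assoc)

text \<open>Division with remainder: the remainder is kept in the state, and the quotient is
  subtracted from the counter.\<close>

lemma verdict_Down_replicate:
  assumes "i < k"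
  shows "verdict p (replicate x 0 @ w) (Down k i) c =
     verdict p w (Down k ((i + x) mod k)) (c - int ((i + x) div k))"
  using assms
proof (induction x arbitrary: i c)
  case (Suc x)
  show ?case
  proof (cases "Suc i = k")
    case True
    then have *: "i + Suc x = k + x" by simp
    have "verdict p (replicate (Suc x) 0 @ w) (Down k i) c =
        verdict p (replicate x 0 @ w) (Down k 0) (c - 1)"
      using True by (simp add: bind_return_pmf)
    also have "\<dots> = verdict p w (Down k (x mod k)) (c - 1 - int (x div k))"
      using Suc.IH[of 0 "c - 1"] Suc.prems by simp
    also have "x mod k = (i + Suc x) mod k"
      by (simp only: * mod_add_self1)
    also have "c - 1 - int (x div k) = c - int ((i + Suc x) div k)"
      using Suc.prems by (simp only: *) simp
    finally show ?thesis .
  next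
    case False
    then have "verdict p (replicate (Suc x) 0 @ w) (Down k i) c =
        verdict p (replicate x 0 @ w) (Down k (Suc i)) c"
      by (simp add: bind_return_pmf)
    also have "\<dots> = verdict p w (Down k ((Suc i + x) mod k)) (c - int ((Suc i + x) div k))"
      by (rule Suc.IH) (use False Suc.prems in simp)
    finally show ?thesis by (simp only: add_Suc_shift)
  qed
qed simp

lemma factor_pos: "0 < factor m"
  by (simp add: factor_def)

lemma div_mod_eq_iff:
  assumes "0 < (k :: nat)"
  shows "y mod k = 0 \<and> x = y div k \<longleftrightarrow> y = k * x"
proof
  assume "y mod k = 0 \<and> x = y div k"
  with mult_div_mod_eq[of k y] show "y = k * x" by simp
qed (use assms in simp)

text \<open>The three claims are proved together because markers lead from \<open>Skip\<close> to
  \<open>Up\<close>, from \<open>Up\<close> to \<open>Down\<close> and from \<open>Down\<close> back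
  to \<open>Up\<close>. In the third, \<open>x\<close> is the stored length and \<open>y\<close> the
  run being compared with it.\<close>

lemma verdict_chain:
  assumes "0 \<notin> fst ` set bs"
  shows "verdict p (replicate x 0 @ encode bs) Skip 0 = return_pmf (even_chained x bs)"
    and "verdict p (replicate x 0 @ encode bs) Up 0 = return_pmf (odd_chained x bs)"
    and "0 < k \<Longrightarrow> verdict p (replicate y 0 @ encode bs) (Down k 0) (int x) =
           return_pmf (y = k * x \<and> even_chained y bs)"
  using assms
proof (induction bs arbitrary: x y k)
  case Nil
  {
    case 1
    show ?case by (simp add: verdict_Skip_replicate[where w = "[]", simplified])
  next
    case 2
    show ?case by (simp add: verdict_Up_replicate[where w = "[]", simplified])
  next
    case 3
    then show ?case
      using div_mod_eq_iff[of k y x]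
      by (auto simp: verdict_Down_replicate[where w = "[]", simplified])
  }
next
  case (Cons b bs)
  obtain m z where b: "b = (m, z)" by (cases b)
  {
    case 1
    with b Cons.IH(2)[of z] show ?case
      by (auto simp: verdict_Skip_replicate bind_return_pmf)
  next
    case 2
    with b Cons.IH(3)[OF factor_pos, of z m x] show ?case
      by (auto simp: verdict_Up_replicate bind_return_pmf)
  next
    case 3
    with b Cons.IH(2)[of z] show ?case
      using div_mod_eq_iff[of k y x]
      by (auto simp: verdict_Down_replicate bind_return_pmf verdict_Fail)
  }
qed

lemma verdict_Plateau:
  assumes "0 \<notin> fst ` set bs"
  shows "verdict p (replicate x 0 @ encode bs) Plateau c =
    return_pmf (1 \<notin> fst ` set bs \<and> c = int (length bs))"
proof -
  have rep: "verdict p (replicate x 0 @ w) Plateau c = verdict p w Plateau c" for x w c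
    by (induction x) (simp_all add: bind_return_pmf)
  have "verdict p (encode bs) Plateau c = return_pmf (1 \<notin> fst ` set bs \<and> c = int (length bs))"
    using assms
    by (induction bs arbitrary: c) (auto simp: bind_return_pmf rep verdict_Fail)
  then show ?thesis by (simp add: rep)
qed

lemma verdict_Ascend:
  assumes "0 \<notin> fst ` set bs"
  shows "verdict p (replicate x 0 @ encode bs) Ascend c = return_pmf (peaked c bs)"
proof -
  have rep: "verdict p (replicate x 0 @ w) Ascend c = verdict p w Ascend c" for x w c
    by (induction x) (simp_all add: bind_return_pmf)
  have "verdict p (encode bs) Ascend c = return_pmf (peaked c bs)"
    using assms
    by (induction bs arbitrary: c) (auto simp: bind_return_pmf rep verdict_Plateau)
  then show ?thesis by (simp add: rep)
qed

lemma peakedE: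
  assumes "peaked c bs"
  obtains us ds where "bs = us @ ds" "fst ` set us \<subseteq> {1}" "1 \<notin> fst ` set ds"
    "c + int (length us) = int (length ds)"
proof -
  have "\<exists>us ds. bs = us @ ds \<and> fst ` set us \<subseteq> {1} \<and> 1 \<notin> fst ` set ds \<and>
      c + int (length us) = int (length ds)"
    using assms
  proof (induction c bs rule: peaked.induct)
    case (2 c m x bs)
    show ?case
    proof (cases "m = 1")
      case True
      with 2 obtain us ds where "bs = us @ ds" "fst ` set us \<subseteq> {1}" "1 \<notin> fst ` set ds"
        "c + 1 + int (length us) = int (length ds)"
        by auto
      with True show ?thesis
        by (intro exI[of _ "(m, x) # us"] exI[of _ ds]) auto
    next
      case False
      with 2 show ?thesis
        by (intro exI[of _ "[]"] exI[of _ "(m, x) # bs"]) auto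
    qed
  qed simp
  with that show ?thesis by blast
qed

lemma peaked_append:
  assumes "fst ` set us \<subseteq> {1}" "1 \<notin> fst ` set ds" "c + int (length us) = int (length ds)"
  shows "peaked c (us @ ds)"
  using assms
proof (induction us arbitrary: c)
  case Nil
  then show ?case by (cases ds) auto
next
  case (Cons u us)
  then show ?case by (cases u) auto
qed

lemma chained_append_ascending:
  "fst ` set us \<subseteq> {1} \<Longrightarrow>
   chained x (us @ ds) \<longleftrightarrow> chained x us \<and> chained (100 ^ length us * x) ds"
  by (induction us arbitrary: x) (auto simp: factor_def mult.assoc mult.left_commute)

lemma chained_level:
  "1 \<notin> fst ` set ds \<Longrightarrow> chained g ds \<longleftrightarrow> snd ` set ds \<subseteq> {g}"
  by (induction ds arbitrary: g) (auto simp: factor_def)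

section \<open>The coin-tossing test\<close>

fun tosses :: "nat \<Rightarrow> nat list \<Rightarrow> nat" where
  "tosses m [] = 0"
| "tosses m (x # w) = (if x = 0 then (if m = 1 then 0 else 1) + tosses m w else tosses x w)"

fun debits :: "nat \<Rightarrow> nat list \<Rightarrow> nat" where
  "debits m [] = 0"
| "debits m (x # w) = (if x = 0 then (if m = 2 then 1 else 0) + debits m w else debits x w)"

text \<open>The final counter is \<open>c\<close> plus the number of heads minus the debits, and the
  test passes iff it is nonnegative. The hypothesis on \<open>b\<close> is the sign invariant
  maintained by the induction.\<close>

lemma verdict_Toss:
  assumes p: "p \<in> {0..1}" and inv: "c \<noteq> 0 \<Longrightarrow> b \<longleftrightarrow> 0 < c"
  shows "verdict p w (Toss m b) c =
    map_pmf (\<lambda>h. int (debits m w) \<le> c + int h) (binomial_pmf (tosses m w) p)"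
  using inv
proof (induction w arbitrary: m b c)
  case Nil
  then show ?case using p by (cases "c = 0") (auto simp: binomial_pmf_0)
next
  case (Cons x w)
  show ?case
  proof (cases "x = 0 \<and> m \<noteq> 1")
    case True
    let ?b = "\<lambda>h. if c = 0 then 0 \<le> toss_effect m h else b"
    have IH: "verdict p w (Toss m (?b h)) (c + toss_effect m h) =
      map_pmf (\<lambda>k. int (debits m w) \<le> c + toss_effect m h + int k) (binomial_pmf (tosses m w) p)" for h
      by (rule Cons.IH) (use Cons.prems in \<open>auto simp: toss_effect_def\<close>)
    have "verdict p (x # w) (Toss m b) c =
      bind_pmf (bernoulli_pmf p) (\<lambda>h. verdict p w (Toss m (?b h)) (c + toss_effect m h))"
      using True by (simp add: bind_map_pmf)
    also have "\<dots> = bind_pmf (bernoulli_pmf p) (\<lambda>h. map_pmf (\<lambda>k. int (debits m (x # w)) \<le>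
        c + int ((if h then 1 else 0) + k)) (binomial_pmf (tosses m w) p))"
      unfolding IH using True
      by (intro bind_pmf_cong map_pmf_cong refl) (auto simp: toss_effect_def)
    \<comment> \<open>A binomial variable with one more trial is a Bernoulli variable plus an
      independent binomial one.\<close>
    also have "\<dots> = map_pmf (\<lambda>h. int (debits m (x # w)) \<le> c + int h)
        (binomial_pmf (Suc (tosses m w)) p)"
      unfolding binomial_pmf_Suc[OF p] map_pmf_def bind_assoc_pmf bind_return_pmf ..
    also have "Suc (tosses m w) = tosses m (x # w)"
      using True by simp
    finally show ?thesis .
  next
    case False
    then show ?thesis
      using Cons.IH[of c b "if x = 0 then m else x"] Cons.prems by (auto simp: bind_return_pmf)
  qed
qed

lemma tosses_encode:
  assumes "0 \<notin> fst ` set bs"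
  shows "tosses m (replicate x 0 @ encode bs) =
    (if m = 1 then 0 else x) + (\<Sum>b\<leftarrow>bs. if fst b = 1 then 0 else snd b)"
proof -
  have rep: "tosses m (replicate x 0 @ w) = (if m = 1 then 0 else x) + tosses m w" for m x w
    by (induction x) auto
  have "tosses m (encode bs) = (\<Sum>b\<leftarrow>bs. if fst b = 1 then 0 else snd b)" for m
    using assms by (induction bs arbitrary: m) (auto simp: rep)
  then show ?thesis by (simp add: rep)
qed

lemma debits_encode:
  assumes "0 \<notin> fst ` set bs"
  shows "debits m (replicate x 0 @ encode bs) =
    (if m = 2 then x else 0) + (\<Sum>b\<leftarrow>bs. if fst b = 2 then snd b else 0)"
proof -
  have rep: "debits m (replicate x 0 @ w) = (if m = 2 then x else 0) + debits m w" for m x w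
    by (induction x) auto
  have "debits m (encode bs) = (\<Sum>b\<leftarrow>bs. if fst b = 2 then snd b else 0)" for m
    using assms by (induction bs arbitrary: m) (auto simp: rep)
  then show ?thesis by (simp add: rep)
qed

section \<open>Tail bounds for the number of heads\<close>

lemma exp_minus_two_le: "exp (- 2 :: real) \<le> 1 / 4"
proof -
  have "(2 :: real) \<le> exp 1" using exp_ge_add_one_self[of 1] by simp
  then have "2 * 2 \<le> exp 1 * exp (1 :: real)" by (intro mult_mono) auto
  also have "\<dots> = exp 2" by (simp flip: exp_add)
  finally show ?thesis by (simp add: exp_minus field_simps)
qed

text \<open>In Hoeffding's inequality a deviation of \<open>sqrt n\<close> gives the bound
  \<open>exp (- 2)\<close> whatever \<open>n\<close> is.\<close>

lemma binomial_tail_le: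
  assumes "p \<in> {0..1}" "0 < n" "real n * p + sqrt (real n) \<le> real a"
  shows "measure_pmf.prob (binomial_pmf n p) {h. a \<le> h} \<le> 1 / 4"
proof -
  interpret binomial_distribution n p by unfold_locales (use assms in auto)
  have "measure_pmf.prob (binomial_pmf n p) {h. a \<le> h} \<le>
      measure_pmf.prob (binomial_pmf n p) {x. real x \<ge> real n * p + sqrt (real n)}"
    using assms(3) by (intro measure_pmf.finite_measure_mono) auto
  also have "\<dots> \<le> exp (-2 * (sqrt (real n))\<^sup>2 / real n)"
    using assms(2) by (intro prob_ge) auto
  also have "\<dots> = exp (- 2)" using assms(2) by simp
  finally show ?thesis using exp_minus_two_le by simp
qed

lemma binomial_tail_ge:
  assumes "p \<in> {0..1}" "0 < n" "real a \<le> real n * p - sqrt (real n)"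
  shows "3 / 4 \<le> measure_pmf.prob (binomial_pmf n p) {h. a \<le> h}"
proof -
  interpret binomial_distribution n p by unfold_locales (use assms in auto)
  have "1 - measure_pmf.prob (binomial_pmf n p) {h. a \<le> h} =
      measure_pmf.prob (binomial_pmf n p) (UNIV - {h. a \<le> h})"
    using measure_pmf.prob_compl[of "{h. a \<le> h}" "binomial_pmf n p"] by simp
  also have "\<dots> \<le> measure_pmf.prob (binomial_pmf n p) {x. real x \<le> real n * p - sqrt (real n)}"
    using assms(3) by (intro measure_pmf.finite_measure_mono) auto
  also have "\<dots> \<le> exp (-2 * (sqrt (real n))\<^sup>2 / real n)"
    using assms(2) by (intro prob_le) auto
  also have "\<dots> = exp (- 2)" using assms(2) by simp
  finally show ?thesis using exp_minus_two_le by simp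
qed

section \<open>The languages\<close>

text \<open>The gap shrinks fast enough for the excluded intervals to have small total length, yet
  slowly enough to be detected by \<open>100 ^ M\<close> tosses.\<close>

definition separated :: "real set" where
  "separated = {p \<in> {0<..<1}. \<forall>M \<ge> 1. \<forall>i \<le> M. 1 / 10 ^ M \<le> \<bar>p - real i / real M\<bar>}"

lemma uncountable_separated: "uncountable separated"
proof
  assume "countable separated"
  \<comment> \<open>The index is shifted by one: \<open>B M\<close> collects the biases too close to
    a fraction with denominator \<open>Suc M\<close>.\<close>
  define B where "B M = (\<Union>i\<le>Suc M. ball (real i / real (Suc M)) (1 / 10 ^ Suc M))" for M
  have B_sets: "B M \<in> sets borel" for M
    unfolding B_def by auto
  have B_le: "emeasure lborel (B M) \<le> ennreal (2 / 5 * (1 / 5) ^ M)" for M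
  proof -
    have "emeasure lborel (B M) \<le>
        (\<Sum>i\<le>Suc M. emeasure lborel (ball (real i / real (Suc M)) (1 / 10 ^ Suc M)))"
      unfolding B_def by (rule emeasure_subadditive_finite) auto
    also have "\<dots> = (\<Sum>i\<le>Suc M. ennreal (2 / 10 ^ Suc M))"
    proof (intro sum.cong refl)
      fix i
      have "ball (real i / real (Suc M)) (1 / 10 ^ Suc M) =
          {real i / real (Suc M) - 1 / 10 ^ Suc M <..< real i / real (Suc M) + 1 / 10 ^ Suc M}"
        by (rule ball_eq_greaterThanLessThan)
      then show "emeasure lborel (ball (real i / real (Suc M)) (1 / 10 ^ Suc M)) =
          ennreal (2 / 10 ^ Suc M)"
        by (simp del: of_nat_Suc power_Suc)
    qed
    also have "\<dots> = ennreal (\<Sum>i\<le>Suc M. 2 / 10 ^ Suc M)"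
      by (rule sum_ennreal) simp
    also have "\<dots> \<le> ennreal (2 / 5 * (1 / 5) ^ M)"
    proof (rule ennreal_leI)
      \<comment> \<open>The \<open>M + 2\<close> intervals number at most \<open>2 ^ Suc M\<close>,
        which turns the powers of 1/10 into powers of 1/5.\<close>
      have "Suc M < 2 ^ Suc M" by (rule less_exp)
      then have "real (Suc (Suc M)) \<le> real (2 ^ Suc M)" unfolding of_nat_le_iff by simp
      then have "real (Suc (Suc M)) * (2 / 10 ^ Suc M) \<le> 2 ^ Suc M * (2 / 10 ^ Suc M)"
        by (intro mult_right_mono) simp_all
      also have "\<dots> = 2 * (2 / 10) ^ Suc M"
        by (simp only: power_divide times_divide_eq_right mult.commute)
      also have "\<dots> = 2 / 5 * (1 / 5) ^ M" by simp
      finally show "(\<Sum>i\<le>Suc M. 2 / 10 ^ Suc M) \<le> 2 / 5 * (1 / 5 :: real) ^ M"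
        by simp
    qed
    finally show ?thesis .
  qed
  have sums: "(\<lambda>M. 2 / 5 * (1 / 5) ^ M) sums (1 / 2 :: real)"
    using sums_mult[OF geometric_sums[of "1 / 5 :: real"], of "2 / 5"] by simp
  \<comment> \<open>If \<open>separated\<close> were countable, hence null, the sets
    \<open>B M\<close> of total measure at most 1/2 would cover an interval of length 1 up to a null
    set.\<close>
  have "{0<..<1} \<subseteq> separated \<union> (\<Union>M. B M)"
  proof
    fix p :: real assume p: "p \<in> {0<..<1}"
    show "p \<in> separated \<union> (\<Union>M. B M)"
    proof (cases "p \<in> separated")
      case False
      with p obtain M i where M: "1 \<le> M" "i \<le> M" "\<bar>p - real i / real M\<bar> < 1 / 10 ^ M"
        unfolding separated_def by force
      then have "p \<in> B (M - 1)"
        unfolding B_def by (auto simp: dist_real_def abs_minus_commute intro!: bexI[of _ i] simp del: power_Suc)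
      then show ?thesis by blast
    qed simp
  qed
  moreover have sep_sets: "separated \<in> sets lborel"
    using \<open>countable separated\<close> by (intro null_setsD2 countable_imp_null_set_lborel)
  ultimately have "emeasure lborel {0<..<1 :: real} \<le> emeasure lborel (separated \<union> (\<Union>M. B M))"
    using B_sets by (intro emeasure_mono sets.Un sets.countable_UN) auto
  also have "\<dots> \<le> emeasure lborel separated + emeasure lborel (\<Union>M. B M)"
    using sep_sets B_sets by (intro emeasure_subadditive sets.countable_UN) auto
  also have "emeasure lborel separated = 0"
    using \<open>countable separated\<close> by (rule emeasure_lborel_countable)
  also have "emeasure lborel (\<Union>M. B M) \<le> (\<Sum>M. emeasure lborel (B M))"
    using B_sets by (intro emeasure_subadditive_countably) auto
  also have "\<dots> \<le> (\<Sum>M. ennreal (2 / 5 * (1 / 5) ^ M))"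
    by (intro suminf_le B_le) auto
  also have "\<dots> = ennreal (1 / 2)"
    using sums by (intro suminf_ennreal_eq) auto
  also have "emeasure lborel {0<..<1 :: real} = ennreal 1"
    by simp
  finally have "ennreal 1 \<le> ennreal (1 / 2)"
    by (simp only: add_0)
  then show False
    by (subst (asm) ennreal_le_iff) simp_all
qed

text \<open>A well-formed word whose coin test asks whether \<open>i / M < p\<close>; its unmarked
  run has length 1.\<close>

definition ratio_word :: "nat \<Rightarrow> nat \<Rightarrow> nat list" where
  "ratio_word i M = replicate 1 0 @ encode (map (\<lambda>j. (1, 100 ^ Suc j)) [0..<M] @
     replicate i (2, 100 ^ M) @ replicate (M - i) (3, 100 ^ M))"

section \<open>Acceptance probabilities of ill-formed and well-formed words\<close>

lemma sum_list_level:
  assumes "snd ` set ds \<subseteq> {g}"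
  shows "(\<Sum>b\<leftarrow>ds. if P b then snd b else (0 :: nat)) = length (filter P ds) * g"
  using assms by (induction ds) auto

text \<open>One of the three deterministic tests surely fails, so the four tests contribute at most
  2 + 1 of 7.\<close>

lemma accept_prob_reject:
  assumes "w = replicate x 0 @ encode bs" "0 \<notin> fst ` set bs"
    and "\<not> (chained x bs \<and> peaked 0 bs)"
  shows "accept_prob (machine p) w \<le> 13 / 28"
proof -
  have "accept_prob (machine p) w =
     (of_bool (even_chained x bs) + of_bool (odd_chained x bs) + of_bool (peaked 0 bs) +
       pmf (verdict p w (Toss 1 True) 0) True) / 7"
    unfolding accept_prob_machine assms(1)
    by (simp add: verdict_chain[OF assms(2)] verdict_Ascend[OF assms(2)] verdict_Fail indicator_def)
  moreover have "pmf (verdict p w (Toss 1 True) 0) True \<le> 1" by (rule pmf_le_1)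
  moreover have "of_bool (even_chained x bs) + of_bool (odd_chained x bs) + of_bool (peaked 0 bs)
      \<le> (2 :: real)"
    using assms(3) by (simp add: chained_iff)
  ultimately show ?thesis by simp
qed

text \<open>The deterministic tests contribute 3, the coin test a binomial tail. Giving
  \<open>i\<close> and \<open>M\<close> as lengths of filtered lists allows them to be computed for
  a concrete word.\<close>

lemma accept_prob_structured:
  assumes "w = replicate x 0 @ encode bs" "0 \<notin> fst ` set bs" "chained x bs" "peaked 0 bs"
    and "p \<in> {0..1}"
  obtains M i where "i \<le> M" "i = length (filter (\<lambda>b. fst b = 2) bs)"
    "M = length (filter (\<lambda>b. fst b \<noteq> 1) bs)"
    "accept_prob (machine p) w =
       (3 + measure_pmf.prob (binomial_pmf (M * (100 ^ M * x)) p) {h. i * (100 ^ M * x) \<le> h}) / 7"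
proof -
  obtain us ds where bs: "bs = us @ ds" "fst ` set us \<subseteq> {1}" "1 \<notin> fst ` set ds"
      "length us = length ds"
    using peakedE[OF assms(4)] by (metis add_0 of_nat_eq_iff)
  define M where "M = length ds"
  define i where "i = length (filter (\<lambda>b. fst b = 2) ds)"
  define g where "g = 100 ^ M * x"
  have g: "snd ` set ds \<subseteq> {g}"
    using assms(3) bs chained_append_ascending[OF bs(2)] chained_level[OF bs(3)]
    by (simp add: g_def M_def)
  have us0: "filter (\<lambda>b. fst b \<noteq> 1) us = []" "filter (\<lambda>b. fst b = 2) us = []"
    using bs(2) by (auto simp: filter_empty_conv)
  have ds1: "filter (\<lambda>b. fst b \<noteq> 1) ds = ds"
    using bs(3) by (force simp: filter_id_conv)
  have "tosses 1 w = (\<Sum>b\<leftarrow>bs. if fst b \<noteq> 1 then snd b else 0)"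
    unfolding assms(1) tosses_encode[OF assms(2)]
    by (auto intro!: arg_cong[where f = sum_list] map_cong)
  also have "\<dots> = (\<Sum>b\<leftarrow>us. if fst b \<noteq> 1 then snd b else 0) + (\<Sum>b\<leftarrow>ds. if fst b \<noteq> 1 then snd b else 0)"
    by (simp add: bs(1))
  also have "(\<Sum>b\<leftarrow>us. if fst b \<noteq> 1 then snd b else 0) = 0"
    using bs(2) by auto
  also have "(\<Sum>b\<leftarrow>ds. if fst b \<noteq> 1 then snd b else 0) = M * g"
    using sum_list_level[OF g] ds1 by (simp add: M_def)
  finally have t: "tosses 1 w = M * g" by simp
  have "debits 1 w = (\<Sum>b\<leftarrow>bs. if fst b = 2 then snd b else 0)"
    unfolding assms(1) debits_encode[OF assms(2)] by simp
  also have "\<dots> = (\<Sum>b\<leftarrow>us. if fst b = 2 then snd b else 0) + (\<Sum>b\<leftarrow>ds. if fst b = 2 then snd b else 0)"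
    by (simp add: bs(1))
  also have "(\<Sum>b\<leftarrow>us. if fst b = 2 then snd b else 0) = 0"
    using bs(2) by auto
  also have "(\<Sum>b\<leftarrow>ds. if fst b = 2 then snd b else 0) = i * g"
    using sum_list_level[OF g] by (simp add: i_def)
  finally have d: "debits 1 w = i * g" by simp
  have "verdict p w (Toss 1 True) 0 =
      map_pmf (\<lambda>h. int (debits 1 w) \<le> 0 + int h) (binomial_pmf (tosses 1 w) p)"
    by (rule verdict_Toss[OF assms(5)]) simp
  then have "verdict p w (Toss 1 True) 0 = map_pmf (\<lambda>h. i * g \<le> h) (binomial_pmf (M * g) p)"
    by (simp only: t d add_0 of_nat_le_iff)
  then have "accept_prob (machine p) w =
      (3 + measure_pmf.prob (binomial_pmf (M * g) p) {h. i * g \<le> h}) / 7"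
    using assms(3,4) chained_iff[of x bs] unfolding accept_prob_machine
    by (simp add: assms(1) verdict_chain[OF assms(2)] verdict_Ascend[OF assms(2)] verdict_Fail
        pmf_map vimage_def)
  moreover have "i \<le> M" by (simp add: i_def M_def)
  moreover have "i = length (filter (\<lambda>b. fst b = 2) bs)" "M = length (filter (\<lambda>b. fst b \<noteq> 1) bs)"
    using us0 ds1 by (simp_all add: bs(1) i_def M_def)
  ultimately show ?thesis using that by (simp add: g_def)
qed

lemma deviation_bound:
  assumes "p \<in> separated" "1 \<le> M" "i \<le> M" "1 \<le> x"
  defines "g \<equiv> 100 ^ M * x"
  shows "sqrt (real (M * g)) \<le> \<bar>real (M * g) * p - real (i * g)\<bar>"
proof -
  have eq: "real (M * g) * p - real (i * g) = real (M * g) * (p - real i / real M)"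
    using assms(2) by (simp add: field_simps)
  have "(100 :: nat) ^ M * 1 \<le> M * (100 ^ M * x)"
    using assms(2,4) by (metis mult_le_mono le_refl mult_1 mult.commute)
  then have "real (100 ^ M) \<le> real (M * g)"
    unfolding g_def of_nat_le_iff by simp
  moreover have "real (100 ^ M) = (10 ^ M)\<^sup>2"
    by (simp add: power2_eq_square flip: power_mult_distrib)
  ultimately have "10 ^ M \<le> sqrt (real (M * g))"
    by (intro real_le_rsqrt) simp
  \<comment> \<open>With \<open>N = M * g\<close>, multiplying \<open>10 ^ M \<le> sqrt N\<close> by
    \<open>sqrt N\<close> shows that the gap \<open>1 / 10 ^ M\<close>, scaled by \<open>N\<close>,
    is at least \<open>sqrt N\<close>.\<close>
  then have "sqrt (real (M * g)) * 10 ^ M \<le> sqrt (real (M * g)) * sqrt (real (M * g))"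
    by (intro mult_left_mono) simp_all
  then have "sqrt (real (M * g)) * 10 ^ M \<le> real (M * g)"
    by simp
  then have "sqrt (real (M * g)) \<le> real (M * g) * (1 / 10 ^ M)"
    by (simp add: field_simps)
  also have "\<dots> \<le> real (M * g) * \<bar>p - real i / real M\<bar>"
    using assms(1-3) by (intro mult_left_mono) (auto simp: separated_def)
  finally show ?thesis
    unfolding eq abs_mult by simp
qed

lemma accept_prob_binomial:
  assumes "p \<in> separated" "1 \<le> M" "i \<le> M" "1 \<le> x"
  defines "P \<equiv> measure_pmf.prob (binomial_pmf (M * (100 ^ M * x)) p) {h. i * (100 ^ M * x) \<le> h}"
  shows "real i / real M < p \<Longrightarrow> 3 / 4 \<le> P" "p < real i / real M \<Longrightarrow> P \<le> 1 / 4"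
proof -
  have p: "p \<in> {0..1}" using assms(1) by (auto simp: separated_def)
  have pos: "0 < M * (100 ^ M * x)" using assms(2,4) by simp
  have Mx: "0 < real M" "0 < 100 ^ M * real x" using assms(2,4) by simp_all
  note dev = deviation_bound[OF assms(1-4)]
  {
    assume "real i / real M < p"
    then have "real i < p * real M" using Mx by (simp add: field_simps)
    then have "real i * (100 ^ M * real x) < p * real M * (100 ^ M * real x)"
      using Mx(2) by (rule mult_strict_right_mono)
    then have "real (i * (100 ^ M * x)) < real (M * (100 ^ M * x)) * p"
      by (simp add: mult_ac)
    with dev show "3 / 4 \<le> P"
      unfolding P_def by (intro binomial_tail_ge p pos) linarith
  next
    assume "p < real i / real M"
    then have "p * real M < real i" using Mx by (simp add: field_simps)
    then have "p * real M * (100 ^ M * real x) < real i * (100 ^ M * real x)"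
      using Mx(2) by (rule mult_strict_right_mono)
    then have "real (M * (100 ^ M * x)) * p < real (i * (100 ^ M * x))"
      by (simp add: mult_ac)
    with dev show "P \<le> 1 / 4"
      unfolding P_def by (intro binomial_tail_le p pos) linarith
  }
qed

lemma separated_neq:
  assumes "p \<in> separated" "1 \<le> M" "i \<le> M"
  shows "p \<noteq> real i / real M"
proof
  assume "p = real i / real M"
  moreover have "1 / 10 ^ M \<le> \<bar>p - real i / real M\<bar>"
    using assms by (simp add: separated_def)
  ultimately have "(1 :: real) / 10 ^ M \<le> 0" by (simp only: diff_self abs_zero)
  moreover have "0 < (1 :: real) / 10 ^ M" by simp
  ultimately show False by linarith
qed

lemma accept_prob_gap:
  assumes "p \<in> separated" "w \<in> lists {0, 1, 2, 3}"
  shows "accept_prob (machine p) w \<le> 13 / 28 \<or> 15 / 28 \<le> accept_prob (machine p) w"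
proof -
  have p: "p \<in> {0..1}" using assms(1) by (auto simp: separated_def)
  obtain x bs where w: "w = replicate x 0 @ encode bs" "fst ` set bs \<subseteq> {1, 2, 3}"
    using encode_exhaust[OF assms(2)] .
  then have bs: "0 \<notin> fst ` set bs" by auto
  show ?thesis
  proof (cases "chained x bs \<and> peaked 0 bs")
    case False
    then show ?thesis using accept_prob_reject[OF w(1) bs] by blast
  next
    case True
    then obtain M i where Mi: "i \<le> M" "accept_prob (machine p) w =
       (3 + measure_pmf.prob (binomial_pmf (M * (100 ^ M * x)) p) {h. i * (100 ^ M * x) \<le> h}) / 7"
      using accept_prob_structured[OF w(1) bs _ _ p] by blast
    show ?thesis
    proof (cases "1 \<le> M \<and> 1 \<le> x")
      case True
      \<comment> \<open>A tail of at least 3/4 gives (3 + 3/4) / 7 = 15/28, one of at most 1/4 gives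
        (3 + 1/4) / 7 = 13/28; a tie is excluded by \<open>separated_neq\<close>.\<close>
      then show ?thesis
        using accept_prob_binomial[OF assms(1), of M i x] separated_neq[OF assms(1), of M i] Mi
        by (cases "real i / real M < p") auto
    next
      case False
      \<comment> \<open>Without tosses the threshold is 0 as well, so the coin test surely passes
        and the total is 4/7 = 16/28.\<close>
      then have "M * (100 ^ M * x) = 0" "i * (100 ^ M * x) = 0" using Mi(1) by auto
      then have "accept_prob (machine p) w = 4 / 7"
        using Mi(2) p by (simp only: binomial_pmf_0) simp
      then show ?thesis by simp
    qed
  qed
qed

section \<open>Distinct biases yield distinct languages\<close>

lemma chained_geometric:
  "chained x (map (\<lambda>j. (1, 100 ^ Suc j * x)) [0..<n] @ ds) \<longleftrightarrow> chained (100 ^ n * x) ds"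
proof (induction n arbitrary: x)
  case (Suc n)
  \<comment> \<open>The first block is split off by moving its factor 100 into the start value,
    which is why \<open>x\<close> is arbitrary.\<close>
  have "map (\<lambda>j. (1 :: nat, 100 ^ Suc j * x)) [0..<Suc n] =
      (1, 100 * x) # map (\<lambda>j. (1, 100 ^ Suc j * (100 * x))) [0..<n]"
    unfolding upt_conv_Cons[OF zero_less_Suc] map_Suc_upt[symmetric] by (simp add: mult_ac)
  with Suc[of "100 * x"] show ?case by (simp add: factor_def mult_ac)
qed simp

lemma accept_prob_ratio_word:
  assumes "p \<in> separated" "1 \<le> M" "i \<le> M"
  shows "ratio_word i M \<in> lists {0, 1, 2, 3}"
    and "1 / 2 < accept_prob (machine p) (ratio_word i M) \<longleftrightarrow> real i / real M < p"
proof -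
  have p: "p \<in> {0..1}" using assms(1) by (auto simp: separated_def)
  define ds where "ds = replicate i (2 :: nat, 100 ^ M :: nat) @ replicate (M - i) (3, 100 ^ M)"
  define us where "us = map (\<lambda>j. (1 :: nat, 100 ^ Suc j :: nat)) [0..<M]"
  have w: "ratio_word i M = replicate 1 0 @ encode (us @ ds)"
    by (simp add: ratio_word_def us_def ds_def)
  have "set (encode bs) \<subseteq> {0} \<union> fst ` set bs" for bs
    by (induction bs) auto
  from this[of "us @ ds"] show "ratio_word i M \<in> lists {0, 1, 2, 3}"
    unfolding w by (force simp: us_def ds_def split: if_splits)
  have bs: "0 \<notin> fst ` set (us @ ds)" by (auto simp: us_def ds_def)
  have ds1: "1 \<notin> fst ` set ds" by (auto simp: ds_def)
  have us1: "fst ` set us \<subseteq> {1}" by (auto simp: us_def)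
  have "chained 1 (us @ ds)"
    using chained_geometric[of 1 M ds] chained_level[OF ds1, of "100 ^ M"]
    by (auto simp: us_def ds_def)
  moreover have "peaked 0 (us @ ds)"
    by (rule peaked_append[OF us1 ds1]) (use assms(3) in \<open>simp add: us_def ds_def\<close>)
  ultimately obtain M' i' where Mi:
      "i' = length (filter (\<lambda>b. fst b = 2) (us @ ds))"
      "M' = length (filter (\<lambda>b. fst b \<noteq> 1) (us @ ds))"
      "accept_prob (machine p) (ratio_word i M) = (3 + measure_pmf.prob
         (binomial_pmf (M' * (100 ^ M' * 1)) p) {h. i' * (100 ^ M' * 1) \<le> h}) / 7"
    using accept_prob_structured[OF w bs _ _ p] by blast
  have "i' = i" "M' = M"
    using assms(3) unfolding Mi(1,2) by (auto simp: us_def ds_def filter_empty_conv)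
  then show "1 / 2 < accept_prob (machine p) (ratio_word i M) \<longleftrightarrow> real i / real M < p"
    using accept_prob_binomial[OF assms(1-3), of 1] separated_neq[OF assms] unfolding Mi(3)
    by (cases "real i / real M < p") auto
qed

text \<open>The cut-off 1/2 lies inside the gap between 13/28 and 15/28.\<close>

definition language :: "real \<Rightarrow> nat list set" where
  "language p = {w \<in> lists {0, 1, 2, 3}. 1 / 2 < accept_prob (machine p) w}"

lemma recognizes_language:
  assumes "p \<in> separated"
  shows "recognizes (machine p) (13 / 28) (language p)"
  unfolding recognizes_def language_def
  using accept_prob_gap[OF assms] by fastforce

text \<open>A rational \<open>i / M\<close> strictly between the two biases makes
  \<open>ratio_word i M\<close> a word of exactly one of the languages.\<close>

lemma language_neq:
  assumes "p \<in> separated" "q \<in> separated" "p < q"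
  shows "language p \<noteq> language q"
proof -
  obtain r :: rat where r: "p < of_rat r" "of_rat r < q"
    using of_rat_dense[OF assms(3)] by blast
  have "0 < p" "q < 1" using assms(1,2) by (auto simp: separated_def)
  with r have "0 < real_of_rat r" "real_of_rat r < 1" by linarith+
  then have "0 < r" "r < 1" by simp_all
  obtain a b where ab: "r = Fract a b" "0 < b" "coprime a b" by (rule Rat_cases)
  with \<open>0 < r\<close> \<open>r < 1\<close> have "0 < a" "a < b"
    by (simp_all add: zero_less_Fract_iff Fract_less_one_iff)
  define i M where "i = nat a" and "M = nat b"
  have iM: "1 \<le> M" "i \<le> M" "of_rat r = real i / real M"
    using ab \<open>0 < a\<close> \<open>a < b\<close> by (auto simp: i_def M_def of_rat_rat)
  have "ratio_word i M \<in> language q" "ratio_word i M \<notin> language p"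
    using accept_prob_ratio_word[OF assms(1) iM(1,2)] accept_prob_ratio_word[OF assms(2) iM(1,2)] r
    unfolding iM(3) language_def by auto
  then show ?thesis by blast
qed

section \<open>Growth rates and conclusion\<close>

lemma successor_bigo: "(\<lambda>n. real (n + 1)) \<in> O(\<lambda>n. real n)"
  by (rule bigoI[of _ 2]) (auto intro!: eventually_mono[OF eventually_ge_at_top[of 1]])

lemma plus_two_smallo: "(\<lambda>n. real (n + 2)) \<in> o(\<lambda>n. (real n)\<^sup>2)"
proof (rule landau_o.smallI)
  fix c :: real assume c: "0 < c"
  show "\<forall>\<^sub>F n in sequentially. norm (real (n + 2)) \<le> c * norm ((real n)\<^sup>2)"
    \<comment> \<open>For \<open>n \<ge> 1\<close> and \<open>n \<ge> 3 / c\<close> one has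
      \<open>n + 2 \<le> 3 * n \<le> c * n * n\<close>.\<close>
    using eventually_ge_at_top[of 1] eventually_ge_at_top[of "nat \<lceil>3 / c\<rceil>"]
  proof eventually_elim
    case (elim n)
    then have "3 / c \<le> real n" by linarith
    then have "3 * real n \<le> (c * real n) * real n"
      using c by (intro mult_right_mono) (simp_all add: field_simps)
    moreover have "real n + 2 \<le> 3 * real n" using elim(1) by simp
    ultimately have "real n + 2 \<le> (c * real n) * real n" by (rule order_trans[rotated])
    then show ?case by (simp add: power2_eq_square mult.assoc)
  qed
qed

theorem theorem6:
  "uncountable {L :: nat list set.
     \<exists>(M :: (nat, nat) pca) (\<epsilon> :: real) (s :: nat \<Rightarrow> nat) (t :: nat \<Rightarrow> nat).
       is_pca M \<and> sweeping M \<and>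
       0 \<le> \<epsilon> \<and> \<epsilon> < 1 / 2 \<and> recognizes M \<epsilon> L \<and>
       (\<lambda>n. real (s n)) \<in> O(\<lambda>n. real n) \<and> space_bounded M s \<and>
       (\<lambda>n. real (t n)) \<in> o(\<lambda>n. (real n)\<^sup>2) \<and> time_bounded M t}" (is "uncountable ?C")
proof
  assume "countable ?C"
  have "language p \<in> ?C" if "p \<in> separated" for p
    by (rule CollectI, rule exI[of _ "machine p"], rule exI[of _ "13 / 28"],
        rule exI[of _ "\<lambda>n. n + 1"], rule exI[of _ "\<lambda>n. n + 2"])
       (intro conjI is_pca_machine sweeping_machine space_bounded_machine time_bounded_machine
          recognizes_language that successor_bigo plus_two_smallo; simp)
  then have "language ` separated \<subseteq> ?C" by blast
  with \<open>countable ?C\<close> have "countable (language ` separated)"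
    by (rule countable_subset[rotated])
  moreover have "inj_on language separated"
    by (rule linorder_inj_onI') (use language_neq in blast)
  ultimately show False
    using uncountable_separated countable_image_inj_on by blast
qed

end
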